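(* Let $K\subset\mathbb{R}^d$ be the attractor of a contracting iterated function system $\mathcal{F}=\{f_i\}_{i\in[k]}$, let $p=(p_1,\dots,p_k)$ be a probability vector, let $\mu_p$ be the corresponding Bernoulli measure on $\Sigma=[k]^{\mathbb{N}}$, and let $\nu_p=(\pi_K)_*\mu_p$. Let $\mathcal{G}=\{g_i\}_{i\in[k]}$, $g_i(x)=\frac{x}{k}+\frac{i-1}{k}$, be the iterated function system with attractor $Q=[0,1]$, and let $\lambda_p=(\pi_Q)_*\mu_p$. Suppose that $$\mu_p\big(\{w\in\Sigma:\ \operatorname{card}\{\pi_K^{-1}(\pi_K(w))\}>1\}\big)=0.$$ Then the probabilistic iterated function systems $(K,\mathcal{F},\nu_p)$ and $(Q,\mathcal{G},\lambda_p)$ are isomorphic.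
   Context: A contracting iterated function system (IFS) on $\mathbb{R}^d$ is a finite family of injective maps $f_i:\mathbb{R}^d\to\mathbb{R}^d$, $i\in[k]=\{1,\dots,k\}$, with $|f_i(x)-f_i(y)|\le r_i|x-y|$, $0<r_i<1$, whose fixed points are not all identical. Its attractor is the unique nonempty compact $K$ with $K=\bigcup_i f_i(K)$. A probability vector satisfies $p_i>0$ for all $i$ and $\sum_ip_i=1$. The Bernoulli measure $\mu_p$ is the Borel probability measure on $\Sigma$ (product topology) with $\mu_p([i_1\dots i_n])=p_{i_1}\cdots p_{i_n}$ on cylinders $[i_1\dots i_n]=\{j\in\Sigma: j_l=i_l,\ 1\le l\le n\}$. The natural projections are defined by $\{\pi_K(w)\}=\bigcap_{n\ge1}f_{w_1}\circ\cdots\circ f_{w_n}(K)$ and $\{\pi_Q(w)\}=\bigcap_{n\ge1}g_{w_1}\circ\cdots\circ g_{w_n}(Q)$ for $w=(w_1w_2\dots)\in\Sigma$. All measures ($\mu_p$, $\nu_p$, $\lambda_p$) are completed. A triple (attractor, IFS, pushforward of $\mu_p$ under the natural projection) is called a probabilistic IFS. Two probabilistic IFSs $(A,\{f_i\}_{i=1}^k,\nu)$ and $(\tilde A,\{\tilde f_i\}_{i=1}^k,\tilde\nu)$ are isomorphic if there are subsets $A'\subset A$ and $\tilde A'\subset\tilde A$ of full measure and an invertible measure preserving map $\phi:\tilde A'\to A'$ such that for all $x\in\tilde A'$ and $i\in[k]$, $\tilde f_i(x)\in\tilde A'$ and $\phi(\tilde f_i(x))=f_i(\phi(x))$. *)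

theory Defs
  imports "HOL-Probability.Probability"
begin

text \<open>
  Families indexed by \<open>[k]\<close> are functions on \<^typ>\<open>nat\<close> of which only the values on \<open>{1..k}\<close> matter.
  Sequences are indexed from \<open>0\<close>, so the letter \<open>w\<^sub>l\<close> of the mathematical text is \<open>w (l - 1)\<close>.
\<close>

definition contracting_ifs :: "nat \<Rightarrow> (nat \<Rightarrow> 'a::euclidean_space \<Rightarrow> 'a) \<Rightarrow> bool" where
  "contracting_ifs k f \<longleftrightarrow>
     (\<forall>i\<in>{1..k}. inj (f i) \<and>
        (\<exists>r. 0 < r \<and> r < 1 \<and> (\<forall>x y. norm (f i x - f i y) \<le> r * norm (x - y)))) \<and>
     (\<exists>i\<in>{1..k}. \<exists>j\<in>{1..k}. \<exists>x y. f i x = x \<and> f j y = y \<and> x \<noteq> y)"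

text \<open>
  By Hutchinson's theorem, a contracting IFS has exactly one such \<open>K\<close>, so uniqueness
  is not part of the predicate.
\<close>

definition is_attractor :: "nat \<Rightarrow> (nat \<Rightarrow> 'a::euclidean_space \<Rightarrow> 'a) \<Rightarrow> 'a set \<Rightarrow> bool" where
  "is_attractor k f K \<longleftrightarrow> K \<noteq> {} \<and> compact K \<and> K = (\<Union>i\<in>{1..k}. f i ` K)"

definition probability_vector :: "nat \<Rightarrow> (nat \<Rightarrow> real) \<Rightarrow> bool" where
  "probability_vector k p \<longleftrightarrow> (\<forall>i\<in>{1..k}. 0 < p i) \<and> (\<Sum>i\<in>{1..k}. p i) = 1"

definition sequences :: "nat \<Rightarrow> (nat \<Rightarrow> nat) set" where
  "sequences k = (UNIV \<rightarrow> {1..k})"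

definition letter_measure :: "nat \<Rightarrow> (nat \<Rightarrow> real) \<Rightarrow> nat measure" where
  "letter_measure k p = point_measure {1..k} (\<lambda>i. ennreal (p i))"

text \<open>The sets of the product are the Borel sets of \<open>\<Sigma>\<close>; see the lemmas below.\<close>

definition bernoulli_measure :: "nat \<Rightarrow> (nat \<Rightarrow> real) \<Rightarrow> (nat \<Rightarrow> nat) measure" where
  "bernoulli_measure k p = completion (PiM UNIV (\<lambda>_. letter_measure k p))"

text \<open>\<open>word_map f w n\<close> is the composition of \<open>f (w 0)\<close>, ..., \<open>f (w (n - 1))\<close>, the last one applied first.\<close>

primrec word_map :: "(nat \<Rightarrow> 'a \<Rightarrow> 'a) \<Rightarrow> (nat \<Rightarrow> nat) \<Rightarrow> nat \<Rightarrow> 'a \<Rightarrow> 'a" where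
  "word_map f w 0 = id"
| "word_map f w (Suc n) = word_map f w n \<circ> f (w n)"

definition natural_projection ::
    "(nat \<Rightarrow> 'a \<Rightarrow> 'a) \<Rightarrow> 'a set \<Rightarrow> (nat \<Rightarrow> nat) \<Rightarrow> 'a" where
  "natural_projection f A w = the_elem (\<Inter>n\<in>{1..}. word_map f w n ` A)"

definition projected_measure ::
    "nat \<Rightarrow> (nat \<Rightarrow> real) \<Rightarrow> (nat \<Rightarrow> 'a::euclidean_space \<Rightarrow> 'a) \<Rightarrow> 'a set \<Rightarrow> 'a measure" where
  "projected_measure k p f A =
     completion (distr (bernoulli_measure k p) (restrict_space borel A) (natural_projection f A))"

definition unit_ifs :: "nat \<Rightarrow> nat \<Rightarrow> real \<Rightarrow> real" where
  "unit_ifs k i x = x / real k + (real i - 1) / real k"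

definition full_measure_set :: "'a measure \<Rightarrow> 'a set \<Rightarrow> bool" where
  "full_measure_set M A \<longleftrightarrow> A \<in> sets M \<and> space M - A \<in> null_sets M"

definition invertible_measure_preserving :: "'a measure \<Rightarrow> 'b measure \<Rightarrow> ('a \<Rightarrow> 'b) \<Rightarrow> bool" where
  "invertible_measure_preserving M N \<phi> \<longleftrightarrow>
     bij_betw \<phi> (space M) (space N) \<and>
     \<phi> \<in> measurable M N \<and> the_inv_into (space M) \<phi> \<in> measurable N M \<and>
     (\<forall>B\<in>sets N. emeasure M (\<phi> -` B \<inter> space M) = emeasure N B)"

text \<open>
  The map \<open>\<phi>\<close> goes from the second system to the first. \<^const>\<open>restrict_space\<close> takes the trace of
  the completed \<open>\<sigma>\<close>-algebras on the full-measure subsets.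
\<close>

fun isomorphic_ifs ::
    "nat \<Rightarrow> 'a set \<times> (nat \<Rightarrow> 'a \<Rightarrow> 'a) \<times> 'a measure
         \<Rightarrow> 'b set \<times> (nat \<Rightarrow> 'b \<Rightarrow> 'b) \<times> 'b measure \<Rightarrow> bool" where
  "isomorphic_ifs k (A, f, \<nu>) (B, g, \<rho>) \<longleftrightarrow>
     (\<exists>A' B' \<phi>. A' \<subseteq> A \<and> B' \<subseteq> B \<and> full_measure_set \<nu> A' \<and> full_measure_set \<rho> B' \<and>
        invertible_measure_preserving (restrict_space \<rho> B') (restrict_space \<nu> A') \<phi> \<and>
        (\<forall>x\<in>B'. \<forall>i\<in>{1..k}. g i x \<in> B' \<and> \<phi> (g i x) = f i (\<phi> x)))"

text \<open>
  The next lemmas show that \<^const>\<open>bernoulli_measure\<close> is the completion of a Borel measure for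
  the product topology, with the prescribed values on cylinders.
\<close>

lemma prob_space_letter_measure:
  assumes "probability_vector k p"
  shows "prob_space (letter_measure k p)"
proof
  have "emeasure (letter_measure k p) {1..k} = (\<Sum>i\<in>{1..k}. ennreal (p i))"
    by (simp add: letter_measure_def emeasure_point_measure_finite)
  also have "\<dots> = ennreal (\<Sum>i\<in>{1..k}. p i)"
    using assms by (intro sum_ennreal) (auto simp: probability_vector_def intro: less_imp_le)
  finally show "emeasure (letter_measure k p) (space (letter_measure k p)) = 1"
    using assms by (simp add: letter_measure_def space_point_measure probability_vector_def)
qed

lemma space_bernoulli_measure: "space (bernoulli_measure k p) = sequences k"
  by (auto simp: bernoulli_measure_def space_completion space_PiM letter_measure_def
      space_point_measure sequences_def PiE_UNIV_domain)

lemma sets_product_letter_measure: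
  "sets (PiM UNIV (\<lambda>_::nat. letter_measure k p)) = sets (restrict_space borel (sequences k))"
    (is "sets ?P = sets ?R")
proof -
  have sp: "space ?P = sequences k" "space ?R = sequences k"
    using space_bernoulli_measure[of k p]
    by (simp_all add: bernoulli_measure_def space_completion space_restrict_space)
  have "(\<lambda>w. w) \<in> measurable ?P (PiM UNIV (\<lambda>_. borel))"
  proof (rule measurable_PiM_single')
    fix i
    have "(\<lambda>x. x) \<in> measurable (letter_measure k p) borel"
      by (simp add: letter_measure_def point_measure_def)
    then show "(\<lambda>w. w i) \<in> borel_measurable ?P"
      using measurable_compose[OF measurable_component_singleton[of i UNIV "\<lambda>_. letter_measure k p"]]
      by auto
  qed auto
  then have 1: "(\<lambda>w. w) \<in> measurable ?P borel"
    using measurable_cong_sets[OF refl sets_PiM_equal_borel] by blast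
  then have "(\<lambda>w. w) \<in> measurable ?P ?R"
    by (rule measurable_restrict_space2[rotated]) (simp add: sp)
  then have "sets ?R \<subseteq> sets ?P"
    using sets.sets_into_space[of _ ?R] sp by (auto dest!: measurable_sets simp: Int_absorb2)
  moreover have "(\<lambda>w. w) \<in> measurable ?R ?P"
  proof (rule measurable_PiM_single')
    fix i
    have "(\<lambda>w::nat \<Rightarrow> nat. w i) \<in> borel_measurable borel"
      by (intro borel_measurable_continuous_onI continuous_intros) auto
    then have c: "(\<lambda>w. w i) \<in> borel_measurable ?R"
      by (rule measurable_restrict_space1)
    show "(\<lambda>w. w i) \<in> measurable ?R (letter_measure k p)"
    proof (rule measurableI)
      fix w assume "w \<in> space ?R"
      then have "w \<in> sequences k" by (simp only: sp)
      then show "w i \<in> space (letter_measure k p)"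
        by (auto simp: sequences_def letter_measure_def space_point_measure)
    next
      fix A :: "nat set"
      have "A \<in> sets borel" by (intro borel_open Topological_Spaces.open_discrete)
      then show "(\<lambda>w. w i) -` A \<inter> space ?R \<in> sets ?R"
        by (rule measurable_sets[OF c])
    qed
  qed (use sp in \<open>auto simp: sequences_def letter_measure_def space_point_measure PiE_UNIV_domain
      space_restrict_space\<close>)
  then have "sets ?P \<subseteq> sets ?R"
    using sets.sets_into_space[of _ ?P] sp by (auto dest!: measurable_sets simp: Int_absorb2)
  ultimately show ?thesis by blast
qed

lemma emeasure_bernoulli_measure_cylinder:
  assumes "probability_vector k p" and u: "\<And>l. l < n \<Longrightarrow> u l \<in> {1..k}"
  shows "emeasure (bernoulli_measure k p) {w \<in> sequences k. \<forall>l<n. w l = u l}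
         = ennreal (\<Prod>l<n. p (u l))"
proof -
  interpret product_prob_space "\<lambda>_::nat. letter_measure k p" UNIV
    by (intro product_prob_spaceI prob_space_letter_measure assms(1))
  let ?P = "PiM (UNIV :: nat set) (\<lambda>_. letter_measure k p)"
  have sp: "space ?P = sequences k"
    using space_bernoulli_measure[of k p] by (simp add: bernoulli_measure_def space_completion)
  let ?C = "{w \<in> space ?P. \<forall>l\<in>{..<n}. w l \<in> {u l}}"
  have S: "{u l} \<in> sets (letter_measure k p)" if "l < n" for l
    using u[OF that] by (simp add: letter_measure_def sets_point_measure)
  have C: "emeasure ?P ?C = (\<Prod>l<n. emeasure (letter_measure k p) {u l})"
    using S by (intro emeasure_PiM_Collect) auto
  have "?C \<in> sets ?P"
    using S by (intro sets.sets_Collect_finite_All sets_Collect_single) auto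
  moreover have "emeasure (letter_measure k p) {u l} = ennreal (p (u l))" if "l < n" for l
    using u[OF that] by (simp add: letter_measure_def emeasure_point_measure_finite)
  moreover have "{w \<in> sequences k. \<forall>l<n. w l = u l} = ?C"
    by (auto simp: sp)
  moreover have "0 \<le> p (u l)" if "l < n" for l
    using assms u[OF that] by (auto simp: probability_vector_def intro: less_imp_le)
  then have "(\<Prod>l<n. ennreal (p (u l))) = ennreal (\<Prod>l<n. p (u l))"
    by (intro prod_ennreal) auto
  ultimately show ?thesis
    using C by (simp add: bernoulli_measure_def)
qed

text \<open>
  The fixed-point condition forces \<open>k \<ge> 2\<close>, so that \<^const>\<open>unit_ifs\<close> is again a contracting IFS.
\<close>

lemma contracting_ifs_ge_2:
  assumes "contracting_ifs k f"
  shows "2 \<le> k"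
proof (rule ccontr)
  assume "\<not> 2 \<le> k"
  then have eq: "i = 1" if "i \<in> {1..k}" for i using that by auto
  obtain i j x y where ij: "i \<in> {1..k}" "j \<in> {1..k}" "f i x = x" "f j y = y" "x \<noteq> y"
    using assms unfolding contracting_ifs_def by blast
  then have "j = i" using eq by metis
  then have fixed: "f i x - f i y = x - y" using ij by simp
  obtain r where r: "r < 1" "norm (f i x - f i y) \<le> r * norm (x - y)"
    using assms ij(1) unfolding contracting_ifs_def by blast
  have "r * norm (x - y) < 1 * norm (x - y)"
    using r(1) ij(5) by (intro mult_strict_right_mono) auto
  then show False using r(2) fixed by simp
qed

lemma contracting_unit_ifs:
  assumes "2 \<le> k"
  shows "contracting_ifs k (unit_ifs k)"
  unfolding contracting_ifs_def
proof (intro conjI ballI)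
  fix i assume "i \<in> {1..k}"
  show "inj (unit_ifs k i)"
    using assms by (auto simp: inj_def unit_ifs_def)
  have "norm (unit_ifs k i x - unit_ifs k i y) \<le> 1 / real k * norm (x - y)" for x y
  proof -
    have "unit_ifs k i x - unit_ifs k i y = 1 / real k * (x - y)"
      by (simp add: unit_ifs_def right_diff_distrib)
    then show ?thesis by (simp add: abs_mult)
  qed
  then show "\<exists>r. 0 < r \<and> r < 1 \<and>
      (\<forall>x y. norm (unit_ifs k i x - unit_ifs k i y) \<le> r * norm (x - y))"
    using assms by (intro exI[of _ "1 / real k"]) auto
next
  have "unit_ifs k 1 0 = 0" "unit_ifs k k 1 = 1"
    using assms by (simp_all add: unit_ifs_def field_simps)
  moreover have "1 \<in> {1..k}" "k \<in> {1..k}" using assms by auto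
  ultimately show "\<exists>i\<in>{1..k}. \<exists>j\<in>{1..k}. \<exists>x y. unit_ifs k i x = x \<and> unit_ifs k j y = y \<and> x \<noteq> y"
    by (metis zero_neq_one)
qed

lemma attractor_unit_ifs:
  assumes "2 \<le> k"
  shows "is_attractor k (unit_ifs k) {0..1}"
proof -
  have k: "0 < real k" using assms by simp
  have "unit_ifs k i x \<in> {0..1}" if "i \<in> {1..k}" "x \<in> {0..1}" for i x
  proof -
    have "unit_ifs k i x = (x + (real i - 1)) / real k"
      by (simp add: unit_ifs_def add_divide_distrib)
    moreover have "0 \<le> x + (real i - 1)" "x + (real i - 1) \<le> real k" using that by auto
    ultimately show ?thesis using k by simp
  qed
  moreover have "\<exists>i\<in>{1..k}. \<exists>x\<in>{0..1}. y = unit_ifs k i x" if y: "y \<in> {0..1}" for y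
  proof (cases "y = 1")
    case True
    then have "y = unit_ifs k k 1" using k by (simp add: unit_ifs_def field_simps)
    then show ?thesis using assms by (intro bexI[of _ k] bexI[of _ 1]) auto
  next
    case False
    define m where "m = nat \<lfloor>real k * y\<rfloor>"
    have "0 \<le> real k * y" "real k * y < real k" using y False k by auto
    then have m: "real m \<le> real k * y" "real k * y < real m + 1" "m < k"
      unfolding m_def by linarith+
    have "y = unit_ifs k (Suc m) (real k * y - real m)"
      using k by (simp add: unit_ifs_def field_simps)
    then show ?thesis
      using m by (intro bexI[of _ "Suc m"] bexI[of _ "real k * y - real m"]) auto
  qed
  ultimately have "{0..1} = (\<Union>i\<in>{1..k}. unit_ifs k i ` {0..1})"
    by (intro equalityI subsetI) (blast+)
  then show ?thesis
    by (simp add: is_attractor_def)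
qed

end

theory Submission
  imports Defs
begin

text \<open>
  Both systems are factors of the shift space \<open>\<Sigma>\<close> through their natural projections \<open>\<pi>\<^sub>K\<close> and \<open>\<pi>\<^sub>Q\<close>,
  so the obvious candidate for the isomorphism is \<open>\<pi>\<^sub>K \<circ> \<pi>\<^sub>Q\<^sup>-\<^sup>1\<close>. It makes sense on \<open>\<pi>\<^sub>Q(X)\<close> as soon as both
  projections are injective on \<open>X \<subseteq> \<Sigma>\<close>, and since \<open>\<pi>(i w) = f\<^sub>i(\<pi>(w))\<close> it intertwines the two systems
  as soon as \<open>X\<close> is closed under putting a letter in front of a sequence.
  
  Let \<open>N\<close> be the set of sequences that share their image under \<open>\<pi>\<^sub>K\<close> or under \<open>\<pi>\<^sub>Q\<close> with another one.
  The complement of \<open>N\<close> need not be closed under prepending, because different pieces \<open>f\<^sub>i(K)\<close> and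
  \<open>f\<^sub>j(K)\<close> may overlap. Hence \<open>X\<close> consists of the \<open>w\<close> with \<open>u w \<notin> N\<close> for all finite words \<open>u\<close>. As all
  \<open>p\<^sub>i\<close> are positive, \<open>{w. i w \<in> N}\<close> is null whenever \<open>N\<close> is (\<open>AE_prepend_letter\<close>), and there are only
  countably many words, so \<open>X\<close> has full measure. The \<open>\<pi>\<^sub>K\<close>-part of \<open>N\<close> is null by hypothesis. The
  \<open>\<pi>\<^sub>Q\<close>-part consists of expansions to base \<open>k\<close> that end in a constant tail of first or last digits
  (\<open>multiply_coded_eventually_constant\<close>); these are null because \<open>k \<ge> 2\<close> forces \<open>p\<^sub>i < 1\<close>.
  
  Measurability is settled by compactness. \<open>\<Sigma>\<close> is compact and the projections are continuous, so \<open>N\<close>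
  and \<open>\<Sigma> - X\<close> are countable unions of compact sets, and so are their images. As a point of \<open>\<pi>(X)\<close> has
  only one code, \<open>\<pi>(X)\<close> is the difference of \<open>\<pi>(\<Sigma>)\<close> and \<open>\<pi>(\<Sigma> - X)\<close>, hence Borel, and for the same reason
  the inverse of \<open>\<pi>\<close> on \<open>\<pi>(X)\<close> is continuous. So \<open>\<pi>\<close> is an isomorphism of measure spaces from \<open>X\<close> onto
  \<open>\<pi>(X)\<close> (\<open>natural_projection_isomorphism\<close>), for either system.
\<close>

section \<open>Countable unions of compact sets\<close>

text \<open>
  Unlike Borel sets, these sets are stable under continuous images, which is how Borel measurability
  passes from the shift space to the attractor.
\<close>

definition sigma_compact :: "'a::topological_space set \<Rightarrow> bool" where
  "sigma_compact S \<longleftrightarrow> (\<exists>\<C>. countable \<C> \<and> (\<forall>C\<in>\<C>. compact C) \<and> S = \<Union>\<C>)"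

lemma sigma_compact_compact: "compact S \<Longrightarrow> sigma_compact S"
  unfolding sigma_compact_def by (intro exI[of _ "{S}"]) auto

lemma sigma_compact_UN:
  assumes "countable I" and S: "\<And>i. i \<in> I \<Longrightarrow> sigma_compact (S i)"
  shows "sigma_compact (\<Union>i\<in>I. S i)"
proof -
  have "\<forall>i\<in>I. \<exists>\<C>. countable \<C> \<and> (\<forall>C\<in>\<C>. compact C) \<and> S i = \<Union>\<C>"
    using S by (auto simp: sigma_compact_def)
  then obtain \<C> where "\<And>i. i \<in> I \<Longrightarrow> countable (\<C> i) \<and> (\<forall>C\<in>\<C> i. compact C) \<and> S i = \<Union>(\<C> i)"
    by metis
  then show ?thesis
    using assms(1) unfolding sigma_compact_def
    by (intro exI[of _ "\<Union>i\<in>I. \<C> i"]) auto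
qed

lemma sigma_compact_image:
  assumes "sigma_compact S" "continuous_on S h"
  shows "sigma_compact (h ` S)"
proof -
  obtain \<C> where \<C>: "countable \<C>" "\<And>C. C \<in> \<C> \<Longrightarrow> compact C" "S = \<Union>\<C>"
    using assms(1) unfolding sigma_compact_def by blast
  have "compact (h ` C)" if "C \<in> \<C>" for C
    using that \<C> assms(2) by (intro compact_continuous_image) (auto intro: continuous_on_subset)
  then show ?thesis
    using \<C>(1,3) unfolding sigma_compact_def by (intro exI[of _ "(`) h ` \<C>"]) auto
qed

lemma sigma_compact_vimage:
  assumes "sigma_compact S" "compact T" "continuous_on T h"
  shows "sigma_compact (T \<inter> h -` (S :: 'a::t2_space set))"
proof -
  obtain \<C> where \<C>: "countable \<C>" "\<And>C. C \<in> \<C> \<Longrightarrow> compact C" "S = \<Union>\<C>"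
    using assms(1) unfolding sigma_compact_def by blast
  have "compact (T \<inter> h -` C)" if C: "C \<in> \<C>" for C
  proof -
    obtain A where "closed A" "A \<inter> T = h -` C \<inter> T"
      using assms(3) \<C>(2)[OF C] unfolding continuous_on_closed_invariant
      by (meson compact_imp_closed)
    then show ?thesis
      using assms(2) by (metis Int_commute compact_Int_closed)
  qed
  then show ?thesis
    using \<C>(1,3) unfolding sigma_compact_def
    by (intro exI[of _ "(\<lambda>C. T \<inter> h -` C) ` \<C>"]) auto
qed

lemma sigma_compact_imp_borel: "sigma_compact (S :: 'a::t2_space set) \<Longrightarrow> S \<in> sets borel"
  unfolding sigma_compact_def by (blast intro: sets.countable_Union borel_compact)

section \<open>Invertible measure preserving maps\<close>

lemma invertible_measure_preserving_inverse:
  assumes "invertible_measure_preserving M N \<phi>"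
  shows "invertible_measure_preserving N M (the_inv_into (space M) \<phi>)"
proof -
  let ?\<psi> = "the_inv_into (space M) \<phi>"
  have bij: "bij_betw \<phi> (space M) (space N)" and \<phi>: "\<phi> \<in> measurable M N"
    and \<psi>: "?\<psi> \<in> measurable N M"
    and em: "\<And>B. B \<in> sets N \<Longrightarrow> emeasure M (\<phi> -` B \<inter> space M) = emeasure N B"
    using assms unfolding invertible_measure_preserving_def by auto
  have bij': "bij_betw ?\<psi> (space N) (space M)"
    using bij by (rule bij_betw_the_inv_into)
  have inv1: "?\<psi> (\<phi> x) = x" if "x \<in> space M" for x
    using bij that by (simp add: bij_betw_def the_inv_into_f_f)
  have inv2: "\<phi> (?\<psi> y) = y" if "y \<in> space N" for y
    using bij that by (auto simp: bij_betw_def intro: f_the_inv_into_f)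
  have "the_inv_into (space N) ?\<psi> x = \<phi> x" if "x \<in> space M" for x
    using that bij bij' inv1[OF that]
    by (metis bij_betw_apply bij_betw_def the_inv_into_f_f)
  then have "the_inv_into (space N) ?\<psi> \<in> measurable M N"
    using \<phi> by (subst measurable_cong) auto
  moreover have "emeasure N (?\<psi> -` C \<inter> space N) = emeasure M C" if C: "C \<in> sets M" for C
  proof -
    have "\<phi> -` (?\<psi> -` C \<inter> space N) \<inter> space M = C"
      using sets.sets_into_space[OF C] measurable_space[OF \<phi>] inv1 by auto
    then show ?thesis
      using em[OF measurable_sets[OF \<psi> C]] by simp
  qed
  ultimately show ?thesis
    using bij' \<psi> unfolding invertible_measure_preserving_def by blast
qed

lemma invertible_measure_preserving_comp:
  assumes "invertible_measure_preserving L M \<phi>" "invertible_measure_preserving M N \<psi>"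
  shows "invertible_measure_preserving L N (\<psi> \<circ> \<phi>)"
proof -
  have bij: "bij_betw \<phi> (space L) (space M)" "bij_betw \<psi> (space M) (space N)"
    and m: "\<phi> \<in> measurable L M" "\<psi> \<in> measurable M N"
    and i: "the_inv_into (space L) \<phi> \<in> measurable M L" "the_inv_into (space M) \<psi> \<in> measurable N M"
    and em: "\<And>B. B \<in> sets M \<Longrightarrow> emeasure L (\<phi> -` B \<inter> space L) = emeasure M B"
      "\<And>B. B \<in> sets N \<Longrightarrow> emeasure M (\<psi> -` B \<inter> space M) = emeasure N B"
    using assms unfolding invertible_measure_preserving_def by auto
  have bij': "bij_betw (\<psi> \<circ> \<phi>) (space L) (space N)"
    using bij by (rule bij_betw_trans)
  have "the_inv_into (space L) (\<psi> \<circ> \<phi>) y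
      = (the_inv_into (space L) \<phi> \<circ> the_inv_into (space M) \<psi>) y" if "y \<in> space N" for y
    using that bij the_inv_into_comp[of \<psi> \<phi> "space L" y] by (simp add: bij_betw_def)
  then have "the_inv_into (space L) (\<psi> \<circ> \<phi>) \<in> measurable N L"
    using measurable_comp[OF i(2,1)] by (subst measurable_cong) auto
  moreover have "emeasure L ((\<psi> \<circ> \<phi>) -` B \<inter> space L) = emeasure N B" if B: "B \<in> sets N" for B
  proof -
    have "(\<psi> \<circ> \<phi>) -` B \<inter> space L = \<phi> -` (\<psi> -` B \<inter> space M) \<inter> space L"
      using measurable_space[OF m(1)] by auto
    then show ?thesis
      using em(1)[OF measurable_sets[OF m(2) B]] em(2)[OF B] by simp
  qed
  ultimately show ?thesis
    using bij' measurable_comp[OF m] unfolding invertible_measure_preserving_def by blast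
qed

text \<open>
  A Borel isomorphism onto a subset extends to the completions. For \<open>q\<close> this is a general fact about
  image measures. For the inverse, a completed measurable subset of \<open>X\<close> splits into a measurable set and
  a part of a null set \<open>N\<close>; the image of \<open>N\<close> is null because saturation of \<open>X\<close> makes the preimage of
  \<open>q(N)\<close> equal to \<open>N\<close> again.
\<close>

lemma invertible_measure_preserving_completion:
  assumes q: "q \<in> measurable P N" and Y: "Y \<in> sets N"
    and saturated: "q -` Y \<inter> space P = X"
    and bij: "bij_betw q X Y"
    and inverse: "the_inv_into X q \<in> measurable (restrict_space N Y) P"
  shows "invertible_measure_preserving (restrict_space (completion P) X)
           (restrict_space (completion (distr P N q)) Y) q"
proof -
  let ?D = "distr P N q" and ?\<psi> = "the_inv_into X q"
  let ?L = "restrict_space (completion P) X" and ?R = "restrict_space (completion ?D) Y"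
  have X: "X \<in> sets P"
    using measurable_sets[OF q Y] saturated by simp
  have YS: "Y \<subseteq> space N" and XS: "X \<subseteq> space P"
    using X Y sets.sets_into_space by auto
  have inv1: "?\<psi> (q x) = x" if "x \<in> X" for x
    using bij that by (simp add: bij_betw_def the_inv_into_f_f)
  have \<psi>X: "?\<psi> y \<in> X" "q (?\<psi> y) = y" if "y \<in> Y" for y
    using bij that bij_betw_the_inv_into[OF bij]
    by (auto simp: bij_betw_def intro: f_the_inv_into_f)
  have qY: "q x \<in> Y" if "x \<in> X" for x
    using that saturated by auto
  have spL: "space ?L = X" and spR: "space ?R = Y"
    using XS YS by (auto simp: space_restrict_space)
  have qD: "q \<in> measurable (completion P) ?D"
    using q by (simp add: measurable_completion)
  have "distr P ?D q = ?D"
    by (rule distr_cong) auto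
  then have D: "distr (completion P) ?D q = ?D"
    using q by (simp add: distr_completion)
  have qC: "q \<in> measurable (completion P) (completion ?D)"
    using qD D by (intro completion.measurable_completion2) auto
  have pres: "completion ?D = distr (completion P) (completion ?D) q"
    using completion.completion_distr_eq[OF qD] D by simp
  have "q \<in> measurable ?L ?R"
    using qC qY by (intro measurable_restrict_space3) auto
  moreover have "?\<psi> \<in> measurable ?R ?L"
  proof (rule measurableI)
    fix y assume "y \<in> space ?R"
    then show "?\<psi> y \<in> space ?L" using \<psi>X spL spR by simp
  next
    fix S assume "S \<in> sets ?L"
    then have S: "S \<subseteq> X" "S \<in> sets (completion P)"
      using X by (auto simp: sets_restrict_space_iff)
    have im: "?\<psi> -` T \<inter> Y = q ` T" if "T \<subseteq> X" for T
      using that inv1 \<psi>X qY by (auto simp: image_iff) (metis inv1)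
    have borel: "q ` T \<in> sets N" if "T \<in> sets P" "T \<subseteq> X" for T
      using measurable_sets[OF inverse that(1)] Y YS im[OF that(2)]
      by (auto simp: sets_restrict_space_iff space_restrict_space Int_absorb2)
    obtain S1 S2 N' where S12: "S = S1 \<union> S2" "S2 \<subseteq> N'" "N' \<in> null_sets P" "S1 \<in> sets P"
      using sets_completionE[OF S(2)] by metis
    \<comment> \<open>Only the part inside \<open>X\<close> is covered by injectivity of \<open>q\<close>.\<close>
    have N': "N' \<inter> X \<in> null_sets P" "N' \<inter> X \<subseteq> X"
      using S12(3) X by (auto intro: null_set_Int2)
    have "q -` (q ` (N' \<inter> X)) \<inter> space P = N' \<inter> X"
      using saturated XS bij by (auto simp: bij_betw_def inj_on_def)
    then have null: "q ` (N' \<inter> X) \<in> null_sets ?D"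
      using borel[of "N' \<inter> X"] N' q by (subst null_sets_distr_iff) auto
    have "q ` S \<in> sets (completion ?D)"
    proof (rule sets_completionI)
      show "q ` S = q ` S1 \<union> q ` S2" using S12 by auto
      show "q ` S2 \<subseteq> q ` (N' \<inter> X)" using S12 S by auto
      show "q ` S1 \<in> sets ?D" using borel[OF S12(4)] S12 S by auto
    qed (rule null)
    then show "?\<psi> -` S \<inter> space ?R \<in> sets ?R"
      using im[OF S(1)] S(1) qY Y spR by (auto simp: sets_restrict_space_iff)
  qed
  moreover have "emeasure ?L (q -` B \<inter> space ?L) = emeasure ?R B" if "B \<in> sets ?R" for B
  proof -
    have B: "B \<subseteq> Y" "B \<in> sets (completion ?D)"
      using that Y by (auto simp: sets_restrict_space_iff)
    have eq: "q -` B \<inter> space ?L = q -` B \<inter> space (completion P)"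
      using B(1) saturated spL by auto
    have "emeasure ?L (q -` B \<inter> space ?L) = emeasure (completion P) (q -` B \<inter> space ?L)"
      using X spL by (intro emeasure_restrict_space) auto
    also have "\<dots> = emeasure (distr (completion P) (completion ?D) q) B"
      unfolding eq using emeasure_distr[OF qC B(2)] by simp
    also have "\<dots> = emeasure (completion ?D) B"
      using pres by simp
    also have "\<dots> = emeasure ?R B"
      using Y B by (intro emeasure_restrict_space[symmetric]) auto
    finally show ?thesis .
  qed
  ultimately show ?thesis
    using bij unfolding invertible_measure_preserving_def spL spR by blast
qed

section \<open>The space of sequences\<close>

lemma compact_sequences: "compact (sequences k)"
proof -
  have "compactin (product_topology (\<lambda>_::nat. euclidean :: nat topology) UNIV)
          (PiE UNIV (\<lambda>_. {1..k}))"
    by (simp add: compactin_PiE finite_imp_compact)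
  moreover have "PiE UNIV (\<lambda>_. {1..k}) = sequences k"
    by (auto simp: sequences_def PiE_UNIV_domain)
  ultimately show ?thesis
    by (simp add: euclidean_product_topology)
qed

lemma case_nat_in_sequences: "i \<in> {1..k} \<Longrightarrow> w \<in> sequences k \<Longrightarrow> case_nat i w \<in> sequences k"
  by (auto simp: sequences_def Pi_iff split: nat.splits)

lemma tail_in_sequences: "w \<in> sequences k \<Longrightarrow> (\<lambda>n. w (Suc n)) \<in> sequences k"
  by (auto simp: sequences_def)

lemma case_nat_head_tail: "case_nat (w 0) (\<lambda>n. w (Suc n)) = w"
  by (auto split: nat.splits)

lemma prepend_in_sequences:
  "u \<in> lists {1..k} \<Longrightarrow> w \<in> sequences k \<Longrightarrow> foldr case_nat u w \<in> sequences k"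
  by (induction u) (auto intro!: case_nat_in_sequences)

lemma continuous_on_prepend: "continuous_on UNIV (foldr case_nat u :: (nat \<Rightarrow> nat) \<Rightarrow> _)"
proof (induction u)
  case Nil
  then show ?case by (simp add: continuous_on_id id_def)
next
  case (Cons a u)
  have "continuous_on UNIV (\<lambda>w :: nat \<Rightarrow> nat. case_nat a w n)" for n
    by (cases n) (auto intro!: continuous_intros)
  then have "continuous_on UNIV (case_nat a :: (nat \<Rightarrow> nat) \<Rightarrow> _)"
    by (intro continuous_on_coordinatewise_then_product) auto
  then have "continuous_on UNIV (case_nat a \<circ> foldr case_nat u)"
    using Cons by (intro continuous_on_compose) (auto intro: continuous_on_subset)
  then show ?case by simp
qed

lemma compact_cylinder: "compact {w \<in> sequences k. w n = a}"
proof -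
  have "closed ((\<lambda>w::nat\<Rightarrow>nat. w n) -` {a})"
    by (intro closed_vimage continuous_intros) auto
  then have "compact (sequences k \<inter> (\<lambda>w. w n) -` {a})"
    by (intro compact_Int_closed compact_sequences)
  moreover have "sequences k \<inter> (\<lambda>w. w n) -` {a} = {w \<in> sequences k. w n = a}" by auto
  ultimately show ?thesis by simp
qed

abbreviation product_measure :: "nat \<Rightarrow> (nat \<Rightarrow> real) \<Rightarrow> (nat \<Rightarrow> nat) measure" where
  "product_measure k p \<equiv> PiM UNIV (\<lambda>_. letter_measure k p)"

lemma space_product_measure: "space (product_measure k p) = sequences k"
  using space_bernoulli_measure[of k p] by (simp add: bernoulli_measure_def)

lemma AE_letter_measure:
  assumes "probability_vector k p"
  shows "(AE s in letter_measure k p. R s) \<longleftrightarrow> (\<forall>s\<in>{1..k}. R s)"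
  using assms unfolding letter_measure_def AE_point_measure probability_vector_def by auto

text \<open>
  The product measure is the image of (letter measure) \<open>\<otimes>\<close> (product measure) under prepending. By Fubini
  the property holds almost surely on almost every fibre, and each single letter has positive mass.
\<close>

lemma AE_prepend_letter:
  assumes p: "probability_vector k p" and Q: "AE w in product_measure k p. Q w"
    and i: "i \<in> {1..k}"
  shows "AE w in product_measure k p. Q (case_nat i w)"
proof -
  interpret product_prob_space "\<lambda>_::nat. letter_measure k p" UNIV
    by (intro product_prob_spaceI prob_space_letter_measure p)
  interpret sequence_space "letter_measure k p" ..
  interpret pair_sigma_finite "letter_measure k p" S ..
  have "AE x in distr (letter_measure k p \<Otimes>\<^sub>M S) S (\<lambda>(s, \<omega>). case_nat s \<omega>). Q x"
    using Q by (simp only: PiM_iter)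
  then have "AE x in letter_measure k p \<Otimes>\<^sub>M S. Q (case x of (s, \<omega>) \<Rightarrow> case_nat s \<omega>)"
    by (rule AE_distrD[rotated]) simp
  from AE_pair[OF this] have "AE s in letter_measure k p. AE \<omega> in S. Q (case_nat s \<omega>)"
    by simp
  then show ?thesis
    using i unfolding AE_letter_measure[OF p] by blast
qed

lemma AE_prepend:
  assumes p: "probability_vector k p" and Q: "AE w in product_measure k p. Q w"
    and "u \<in> lists {1..k}"
  shows "AE w in product_measure k p. Q (foldr case_nat u w)"
  using assms(3) Q
proof (induction u arbitrary: Q)
  case Nil
  then show ?case by simp
next
  case (Cons a u)
  then show ?case
    using Cons.IH[of "\<lambda>w. Q (case_nat a w)"] AE_prepend_letter[OF p] by auto
qed

text \<open>
  As there is a second letter of positive mass, \<open>p c < 1\<close>. Having the letter \<open>c\<close> at \<open>m\<close> given places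
  has probability \<open>p c ^ m\<close>, which tends to \<open>0\<close>.
\<close>

lemma AE_not_eventually_constant:
  assumes p: "probability_vector k p" and "2 \<le> k" and c: "c \<in> {1..k}"
  shows "AE w in product_measure k p. \<exists>l\<ge>n. w l \<noteq> c"
proof -
  interpret product_prob_space "\<lambda>_::nat. letter_measure k p" UNIV
    by (intro product_prob_spaceI prob_space_letter_measure p)
  let ?P = "product_measure k p"
  have pc: "0 \<le> p c" using p c by (auto simp: probability_vector_def intro: less_imp_le)
  have "p c < 1"
  proof -
    obtain j where j: "j \<in> {1..k}" "j \<noteq> c"
      using \<open>2 \<le> k\<close> by (metis atLeastAtMost_iff le_trans one_le_numeral order_refl numeral_eq_one_iff semiring_norm(85))
    have "p c + p j = sum p {c, j}" using j by simp
    also have "\<dots> \<le> sum p {1..k}"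
      using j c p by (intro sum_mono2) (auto simp: probability_vector_def intro: less_imp_le)
    also have "\<dots> = 1" using p by (simp add: probability_vector_def)
    finally have "p c + p j \<le> 1" .
    moreover have "0 < p j" using p j(1) unfolding probability_vector_def by blast
    ultimately show ?thesis by linarith
  qed
  let ?C = "\<lambda>m. {w \<in> space ?P. \<forall>l\<in>{n..<n + m}. w l \<in> {c}}"
  have S: "{c} \<in> sets (letter_measure k p)"
    using c by (simp add: letter_measure_def sets_point_measure)
  have C: "emeasure ?P (?C m) = ennreal (p c ^ m)" for m
  proof -
    have "emeasure ?P (?C m) = (\<Prod>l\<in>{n..<n + m}. emeasure (letter_measure k p) {c})"
      using S by (intro emeasure_PiM_Collect) auto
    also have "\<dots> = ennreal (p c) ^ m"
      using c by (simp add: letter_measure_def emeasure_point_measure_finite)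
    finally show ?thesis by (simp add: pc ennreal_power)
  qed
  have Cm: "?C m \<in> sets ?P" for m
    using S by (intro sets.sets_Collect_finite_All sets_Collect_single) auto
  let ?I = "\<Inter>m. ?C m"
  have I: "?I \<in> sets ?P" using Cm by (intro sets.countable_INT) auto
  have "(\<lambda>m. ennreal (p c ^ m)) \<longlonglongrightarrow> ennreal 0"
    using pc \<open>p c < 1\<close> by (intro tendsto_ennrealI LIMSEQ_realpow_zero)
  moreover have "emeasure ?P ?I \<le> ennreal (p c ^ m)" for m
    unfolding C[of m, symmetric] by (intro emeasure_mono Cm) auto
  ultimately have "emeasure ?P ?I \<le> ennreal 0"
    by (intro LIMSEQ_le_const) auto
  then have "?I \<in> null_sets ?P" using I by (auto simp: null_sets_def)
  moreover have "{w \<in> space ?P. \<not> (\<exists>l\<ge>n. w l \<noteq> c)} \<subseteq> ?I"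
    by auto
  ultimately show ?thesis by (rule AE_I')
qed

section \<open>The natural projection\<close>

text \<open>
  The defining recursion peels off the innermost map; shifts of sequences require the outermost one.
\<close>

lemma word_map_Suc_head:
  "word_map f w (Suc n) = f (w 0) \<circ> word_map f (\<lambda>n. w (Suc n)) n"
proof (induction n)
  case (Suc n)
  then show ?case by (metis comp_assoc word_map.simps(2))
qed simp

locale contracting_system =
  fixes k :: nat and f :: "nat \<Rightarrow> 'a::euclidean_space \<Rightarrow> 'a" and K :: "'a set"
  assumes contracting: "contracting_ifs k f" and attractor: "is_attractor k f K"
begin

abbreviation proj :: "(nat \<Rightarrow> nat) \<Rightarrow> 'a" where
  "proj \<equiv> natural_projection f K"

lemma compact_K: "compact K" and K_nonempty: "K \<noteq> {}"
  and map_K: "i \<in> {1..k} \<Longrightarrow> x \<in> K \<Longrightarrow> f i x \<in> K"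
  using attractor unfolding is_attractor_def by blast+

lemma uniform_ratio:
  obtains r where "0 \<le> r" "r < 1" "\<And>i x y. i \<in> {1..k} \<Longrightarrow> dist (f i x) (f i y) \<le> r * dist x y"
proof -
  have "\<forall>i\<in>{1..k}. \<exists>r. 0 < r \<and> r < 1 \<and> (\<forall>x y. norm (f i x - f i y) \<le> r * norm (x - y))"
    using contracting unfolding contracting_ifs_def by auto
  then obtain \<rho> where \<rho>: "\<And>i. i \<in> {1..k} \<Longrightarrow> 0 < \<rho> i" "\<And>i. i \<in> {1..k} \<Longrightarrow> \<rho> i < 1"
    "\<And>i x y. i \<in> {1..k} \<Longrightarrow> norm (f i x - f i y) \<le> \<rho> i * norm (x - y)"
    by metis
  \<comment> \<open>Including \<open>0\<close> keeps the maximum well defined and nonnegative even before \<open>k \<ge> 1\<close> is known.\<close>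
  let ?r = "Max (insert 0 (\<rho> ` {1..k}))"
  have "?r < 1" using \<rho>(2) by (subst Max_less_iff) auto
  moreover have "0 \<le> ?r" by simp
  moreover have "dist (f i x) (f i y) \<le> ?r * dist x y" if "i \<in> {1..k}" for i x y
  proof -
    have "\<rho> i \<le> ?r" using that by (intro Max_ge) auto
    then have "\<rho> i * dist x y \<le> ?r * dist x y" by (intro mult_right_mono) auto
    then show ?thesis using \<rho>(3)[OF that, of x y] by (simp add: dist_norm)
  qed
  ultimately show ?thesis using that by blast
qed

lemma word_map_contraction:
  obtains r c where "0 \<le> r" "r < 1"
    "\<And>w n x y. w \<in> sequences k \<Longrightarrow> x \<in> K \<Longrightarrow> y \<in> K
      \<Longrightarrow> dist (word_map f w n x) (word_map f w n y) \<le> r ^ n * c"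
proof -
  obtain r where r: "0 \<le> r" "r < 1"
    and f: "\<And>i x y. i \<in> {1..k} \<Longrightarrow> dist (f i x) (f i y) \<le> r * dist x y"
    by (rule uniform_ratio) blast
  obtain c where c: "\<And>x y. x \<in> K \<Longrightarrow> y \<in> K \<Longrightarrow> dist x y \<le> c"
    using compact_imp_bounded[OF compact_K] by (metis bounded_two_points)
  have "dist (word_map f w n x) (word_map f w n y) \<le> r ^ n * dist x y"
    if w: "w \<in> sequences k" for w n x y
  proof (induction n arbitrary: x y)
    case 0
    then show ?case by simp
  next
    case (Suc n)
    have "w n \<in> {1..k}" using w by (auto simp: sequences_def)
    from f[OF this, of x y]
    have "r ^ n * dist (f (w n) x) (f (w n) y) \<le> r ^ n * (r * dist x y)"
      using r by (intro mult_left_mono) auto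
    with Suc.IH[of "f (w n) x" "f (w n) y"] show ?case by (simp add: ac_simps)
  qed
  moreover have "r ^ n * dist x y \<le> r ^ n * c" if "x \<in> K" "y \<in> K" for n x y
    using c that r by (intro mult_left_mono) auto
  ultimately show ?thesis using that r by (meson order_trans)
qed

lemma word_map_antimono:
  assumes "w \<in> sequences k" "m \<le> n"
  shows "word_map f w n ` K \<subseteq> word_map f w m ` K"
  using assms(2)
proof (induction rule: dec_induct)
  case (step n)
  have "w n \<in> {1..k}" using assms by (auto simp: sequences_def)
  then have "f (w n) ` K \<subseteq> K" using map_K by blast
  then show ?case using step.IH by (fastforce simp: image_comp[symmetric])
qed simp

lemma continuous_on_word_map:
  assumes "w \<in> sequences k"
  shows "continuous_on UNIV (word_map f w n)"
proof (induction n)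
  case 0
  then show ?case by (simp add: id_def)
next
  case (Suc n)
  obtain r where r: "0 \<le> r" "r < 1"
    and f: "\<And>i x y. i \<in> {1..k} \<Longrightarrow> dist (f i x) (f i y) \<le> r * dist x y"
    by (rule uniform_ratio) blast
  have "w n \<in> {1..k}" using assms by (auto simp: sequences_def)
  then have "r-lipschitz_on UNIV (f (w n))"
    using f r by (intro lipschitz_onI) auto
  then have "continuous_on UNIV (f (w n))"
    by (rule lipschitz_on_continuous_on)
  then show ?case using Suc by (auto intro: continuous_on_compose2 simp: comp_def)
qed

lemma word_map_INT_unique:
  assumes w: "w \<in> sequences k" and x: "\<And>n. n \<ge> 1 \<Longrightarrow> x \<in> word_map f w n ` K"
    and y: "\<And>n. n \<ge> 1 \<Longrightarrow> y \<in> word_map f w n ` K"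
  shows "x = y"
proof -
  obtain r c where r: "0 \<le> r" "r < 1"
    and d: "\<And>w n x y. w \<in> sequences k \<Longrightarrow> x \<in> K \<Longrightarrow> y \<in> K
      \<Longrightarrow> dist (word_map f w n x) (word_map f w n y) \<le> r ^ n * c"
    by (rule word_map_contraction) blast
  have "dist x y \<le> r ^ n * c" if "n \<ge> 1" for n
    using x[OF that] y[OF that] d[OF w] by auto
  moreover have "(\<lambda>n. r ^ n * c) \<longlonglongrightarrow> 0"
    using LIMSEQ_realpow_zero[OF r] by (intro tendsto_mult_left_zero)
  ultimately have "dist x y \<le> 0"
    by (intro LIMSEQ_le_const) auto
  then show ?thesis by simp
qed

lemma proj_in_word_map:
  assumes w: "w \<in> sequences k"
  shows "proj w \<in> word_map f w n ` K"
proof -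
  have "compact (word_map f w n ` K)" for n
    by (intro compact_continuous_image compact_K continuous_on_subset[OF continuous_on_word_map[OF w]]) auto
  then have "(\<Inter>n. word_map f w n ` K) \<noteq> {}"
    using K_nonempty word_map_antimono[OF w] by (intro compact_nest) auto
  then obtain x where x: "\<And>n. x \<in> word_map f w n ` K" by auto
  have "(\<Inter>n\<in>{1..}. word_map f w n ` K) = {x}"
    using x word_map_INT_unique[OF w] by fastforce
  then have "proj w = x" by (simp add: natural_projection_def)
  then show ?thesis using x by simp
qed

lemma proj_in_K: "w \<in> sequences k \<Longrightarrow> proj w \<in> K"
  using proj_in_word_map[of w 0] by simp

lemma proj_prepend:
  assumes "i \<in> {1..k}" "w \<in> sequences k"
  shows "proj (case_nat i w) = f i (proj w)"
proof (rule word_map_INT_unique[of "case_nat i w"])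
  show v: "case_nat i w \<in> sequences k"
    using assms by (rule case_nat_in_sequences)
  then show "proj (case_nat i w) \<in> word_map f (case_nat i w) n ` K" for n
    by (rule proj_in_word_map)
  show "f i (proj w) \<in> word_map f (case_nat i w) n ` K" if n: "n \<ge> 1" for n
  proof -
    obtain m where "n = Suc m" using n by (cases n) auto
    moreover obtain x where "x \<in> K" "proj w = word_map f w m x"
      using proj_in_word_map[OF assms(2), of m] by blast
    ultimately show ?thesis by (simp add: word_map_Suc_head del: word_map.simps)
  qed
qed

lemma proj_head_tail:
  assumes "w \<in> sequences k"
  shows "proj w = f (w 0) (proj (\<lambda>n. w (Suc n)))"
proof -
  have "w 0 \<in> {1..k}" using assms by (auto simp: sequences_def)
  from proj_prepend[OF this tail_in_sequences[OF assms]] show ?thesis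
    by (simp only: case_nat_head_tail)
qed

text \<open>
  Sequences that agree in the first \<open>n\<close> letters project into the same piece of order \<open>n\<close>, whose diameter
  tends to \<open>0\<close> geometrically.
\<close>

lemma continuous_on_proj: "continuous_on (sequences k) proj"
  unfolding continuous_on_def
proof (intro ballI tendstoI)
  fix w and e :: real assume w: "w \<in> sequences k" and "0 < e"
  obtain r c where r: "0 \<le> r" "r < 1"
    and d: "\<And>w n x y. w \<in> sequences k \<Longrightarrow> x \<in> K \<Longrightarrow> y \<in> K
      \<Longrightarrow> dist (word_map f w n x) (word_map f w n y) \<le> r ^ n * c"
    by (rule word_map_contraction) blast
  have "(\<lambda>n. r ^ n * c) \<longlonglongrightarrow> 0"
    using LIMSEQ_realpow_zero[OF r] by (intro tendsto_mult_left_zero)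
  then have "\<forall>\<^sub>F n in sequentially. r ^ n * c < e"
    using \<open>0 < e\<close> by (rule order_tendstoD)
  then obtain n where n: "r ^ n * c < e"
    by (auto simp: eventually_sequentially)
  have "((\<lambda>v. v l) \<longlongrightarrow> w l) (at w within sequences k)" for l
  proof -
    have "continuous_on (sequences k) (\<lambda>v. v l)"
      by (rule continuous_on_product_then_coordinatewise[OF continuous_on_id])
    then show ?thesis using w by (auto simp: continuous_on_def)
  qed
  then have "\<forall>\<^sub>F v in at w within sequences k. v l = w l" for l
    by (simp add: tendsto_discrete)
  then have "\<forall>\<^sub>F v in at w within sequences k. \<forall>l\<in>{..<n}. v l = w l"
    by (intro eventually_ball_finite) auto
  moreover have "\<forall>\<^sub>F v in at w within sequences k. v \<in> sequences k"
    by (simp add: eventually_at_filter)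
  ultimately show "\<forall>\<^sub>F v in at w within sequences k. dist (proj v) (proj w) < e"
  proof eventually_elim
    case (elim v)
    have "m \<le> n \<Longrightarrow> word_map f v m = word_map f w m" for m
      using elim(1) by (induction m) auto
    then have "proj v \<in> word_map f w n ` K"
      using proj_in_word_map[OF elim(2), of n] by simp
    then have "dist (proj v) (proj w) \<le> r ^ n * c"
      using proj_in_word_map[OF w, of n] d[OF w] by auto
    then show ?case using n by simp
  qed
qed

definition multiply_coded :: "(nat \<Rightarrow> nat) set" where
  "multiply_coded = {w \<in> sequences k. \<exists>v\<in>sequences k. v \<noteq> w \<and> proj v = proj w}"

lemma multiply_coded_eq:
  "multiply_coded = {w \<in> sequences k.
     let F = {v \<in> sequences k. proj v = proj w} in infinite F \<or> card F > 1}"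
proof -
  have "(infinite F \<or> card F > 1) \<longleftrightarrow> (\<exists>v\<in>F. v \<noteq> w)" if "w \<in> F" for w and F :: "(nat \<Rightarrow> nat) set"
  proof
    assume "infinite F \<or> card F > 1"
    then have "\<not> F \<subseteq> {w}"
      using card_mono[of "{w}" F] finite_subset[of F "{w}"] by auto
    then show "\<exists>v\<in>F. v \<noteq> w" by auto
  next
    assume "\<exists>v\<in>F. v \<noteq> w"
    then obtain v where "v \<in> F" "v \<noteq> w" by blast
    then show "infinite F \<or> card F > 1"
      using that card_mono[of F "{v, w}"] by auto
  qed
  then show ?thesis
    unfolding multiply_coded_def Let_def by (intro Collect_cong conj_cong refl) auto
qed

text \<open>
  A point has two codes iff, for some \<open>n\<close> and letters \<open>a \<noteq> b\<close>, it lies in the images of both cylinders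
  \<open>w n = a\<close> and \<open>w n = b\<close>. These images are compact, and there are countably many triples \<open>(n, a, b)\<close>.
\<close>

lemma multiply_coded_eq_vimage:
  obtains D where "sigma_compact D" "multiply_coded = sequences k \<inter> proj -` D"
proof -
  let ?C = "\<lambda>n a. {w \<in> sequences k. w n = a}"
  let ?T = "{(n, a, b). a \<noteq> (b::nat)} :: (nat \<times> nat \<times> nat) set"
  let ?D = "\<Union>(n, a, b)\<in>?T. proj ` ?C n a \<inter> proj ` ?C n b"
  have "multiply_coded = sequences k \<inter> proj -` ?D"
  proof (intro equalityI subsetI)
    fix w assume "w \<in> multiply_coded"
    then obtain v where v: "v \<in> sequences k" "v \<noteq> w" "proj v = proj w" and w: "w \<in> sequences k"
      by (auto simp: multiply_coded_def)
    then obtain n where "w n \<noteq> v n" by (metis ext)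
    moreover have "proj w \<in> proj ` ?C n (w n)" "proj w \<in> proj ` ?C n (v n)"
      using v w by (auto simp: image_iff)
    ultimately have "proj w \<in> ?D"
      by (intro UN_I[of "(n, w n, v n)"]) auto
    then show "w \<in> sequences k \<inter> proj -` ?D" using w by simp
  next
    fix w assume "w \<in> sequences k \<inter> proj -` ?D"
    then obtain n a b v v' where "a \<noteq> b" and w: "w \<in> sequences k"
      and v: "v \<in> ?C n a" "v' \<in> ?C n b" "proj w = proj v" "proj w = proj v'"
      by auto
    then have "v \<noteq> v'" by auto
    then have "v \<noteq> w \<or> v' \<noteq> w" by auto
    then show "w \<in> multiply_coded"
      using v w by (auto simp: multiply_coded_def)
  qed
  moreover have "compact (proj ` ?C n a)" for n a
    by (intro compact_continuous_image compact_cylinder continuous_on_subset[OF continuous_on_proj]) auto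
  then have "sigma_compact (proj ` ?C n a \<inter> proj ` ?C n b)" for n a b
    by (intro sigma_compact_compact compact_Int)
  then have "sigma_compact ?D"
    by (intro sigma_compact_UN countableI_type) (auto simp only: split: prod.split)
  ultimately show ?thesis using that by blast
qed

lemma sigma_compact_prepend_multiply_coded:
  assumes "u \<in> lists {1..k}"
  shows "sigma_compact (sequences k \<inter> foldr case_nat u -` multiply_coded)"
proof -
  obtain D where D: "sigma_compact D" "multiply_coded = sequences k \<inter> proj -` D"
    by (rule multiply_coded_eq_vimage)
  have "continuous_on (sequences k) (proj \<circ> foldr case_nat u)"
    using assms by (intro continuous_on_compose continuous_on_subset[OF continuous_on_prepend]
        continuous_on_subset[OF continuous_on_proj]) (auto intro: prepend_in_sequences)
  then have "sigma_compact (sequences k \<inter> (proj \<circ> foldr case_nat u) -` D)"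
    using D(1) compact_sequences by (intro sigma_compact_vimage)
  moreover have "sequences k \<inter> foldr case_nat u -` multiply_coded
      = sequences k \<inter> (proj \<circ> foldr case_nat u) -` D"
    using prepend_in_sequences[OF assms] by (auto simp: D(2))
  ultimately show ?thesis by simp
qed

lemma measurable_proj: "proj \<in> measurable (product_measure k p) (restrict_space borel K)"
proof (rule measurable_restrict_space2)
  show "proj \<in> space (product_measure k p) \<rightarrow> K"
    using proj_in_K by (auto simp: space_product_measure)
  have "proj \<in> measurable (restrict_space borel (sequences k)) borel"
    by (intro borel_measurable_continuous_on_restrict continuous_on_proj)
  then show "proj \<in> borel_measurable (product_measure k p)"
    using measurable_cong_sets[OF sets_product_letter_measure[of k p, symmetric] refl] by blast
qed

lemma projected_measure_eq:
  "projected_measure k p f K = completion (distr (product_measure k p) (restrict_space borel K) proj)"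
  by (simp add: projected_measure_def bernoulli_measure_def distr_completion[OF measurable_proj])

text \<open>
  Since no point of \<open>proj ` X\<close> has a code other than the one in \<open>X\<close>, the set \<open>X\<close> is saturated. Therefore
  \<open>proj ` X\<close> is Borel as a difference of sigma-compact sets, and closed subsets of \<open>X\<close> have relatively
  closed images, so that the inverse of the projection is continuous on \<open>proj ` X\<close>.
\<close>

lemma natural_projection_isomorphism:
  assumes X: "X \<subseteq> sequences k" "sigma_compact (sequences k - X)" "X \<inter> multiply_coded = {}"
    and full: "AE w in product_measure k p. w \<in> X"
  shows "full_measure_set (projected_measure k p f K) (proj ` X)"
    and "invertible_measure_preserving (restrict_space (bernoulli_measure k p) X)
           (restrict_space (projected_measure k p f K) (proj ` X)) proj"
proof -
  let ?P = "product_measure k p" and ?N = "restrict_space borel K"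
  have sat: "w = v" if "w \<in> sequences k" "v \<in> X" "proj w = proj v" for w v
    using that X by (auto simp: multiply_coded_def disjoint_iff)
  have inj: "inj_on proj X"
    using sat X by (meson inj_onI subsetD)
  have saturated: "proj -` (proj ` X) \<inter> space ?P = X"
    using sat X by (auto simp: space_product_measure)
  have sub: "proj ` X \<subseteq> K" using X proj_in_K by auto
  have K: "K \<in> sets borel" by (intro borel_compact compact_K)
  have "proj ` X = proj ` sequences k - proj ` (sequences k - X)"
    using sat X by blast
  moreover have "sigma_compact (proj ` sequences k)" "sigma_compact (proj ` (sequences k - X))"
    by (intro sigma_compact_image X sigma_compact_compact compact_sequences
        continuous_on_subset[OF continuous_on_proj]; blast)+
  ultimately have borel: "proj ` X \<in> sets borel"
    by (metis sets.Diff sigma_compact_imp_borel)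
  then have Y: "proj ` X \<in> sets ?N"
    using sub K by (simp add: sets_restrict_space_iff)
  show "full_measure_set (projected_measure k p f K) (proj ` X)"
    unfolding full_measure_set_def
  proof
    show "proj ` X \<in> sets (projected_measure k p f K)"
      using Y by (simp add: projected_measure_eq)
    let ?Z = "space (projected_measure k p f K) - proj ` X"
    have Z: "?Z = K - proj ` X"
      by (simp add: projected_measure_eq space_restrict_space)
    have "?Z \<in> sets ?N"
      using borel K by (auto simp: Z sets_restrict_space_iff)
    moreover have "proj -` ?Z \<inter> space ?P \<in> null_sets ?P"
    proof -
      have "proj -` ?Z \<inter> space ?P = {w \<in> space ?P. w \<notin> X}"
        using saturated proj_in_K by (auto simp: Z space_product_measure)
      moreover have "proj -` ?Z \<inter> space ?P \<in> sets ?P"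
        using \<open>?Z \<in> sets ?N\<close> by (intro measurable_sets[OF measurable_proj])
      ultimately show ?thesis
        using full by (subst (asm) AE_iff_null) auto
    qed
    ultimately show "?Z \<in> null_sets (projected_measure k p f K)"
      unfolding projected_measure_eq
      by (intro null_sets_completionI) (simp add: null_sets_distr_iff[OF measurable_proj])
  qed
  show "invertible_measure_preserving (restrict_space (bernoulli_measure k p) X)
           (restrict_space (projected_measure k p f K) (proj ` X)) proj"
    unfolding projected_measure_eq bernoulli_measure_def
  proof (rule invertible_measure_preserving_completion[OF measurable_proj Y saturated])
    show bij: "bij_betw proj X (proj ` X)" using inj by (simp add: bij_betw_def)
    let ?\<psi> = "the_inv_into X proj"
    have inv: "?\<psi> (proj x) = x" if "x \<in> X" for x
      using that inj by (simp add: the_inv_into_f_f)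
    \<comment> \<open>The preimage of a closed \<open>B\<close> under the inverse is the trace of the compact image of \<open>\<Sigma> \<inter> B\<close>.\<close>
    have "continuous_on (proj ` X) ?\<psi>"
      unfolding continuous_on_closed_invariant
    proof (intro allI impI)
      fix B :: "(nat \<Rightarrow> nat) set" assume "closed B"
      then have "compact (proj ` (sequences k \<inter> B))"
        by (intro compact_continuous_image compact_Int_closed compact_sequences
            continuous_on_subset[OF continuous_on_proj]) auto
      then have "closed (proj ` (sequences k \<inter> B))" by (rule compact_imp_closed)
      moreover have "proj ` (sequences k \<inter> B) \<inter> proj ` X = ?\<psi> -` B \<inter> proj ` X"
        using inv sat X by (auto simp: image_iff)
      ultimately show "\<exists>A. closed A \<and> A \<inter> proj ` X = ?\<psi> -` B \<inter> proj ` X" by blast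
    qed
    then have "?\<psi> \<in> measurable (restrict_space borel (proj ` X)) borel"
      by (rule borel_measurable_continuous_on_restrict)
    then have "?\<psi> \<in> measurable (restrict_space borel (proj ` X)) (restrict_space borel (sequences k))"
      using inv X by (intro measurable_restrict_space2) (auto simp: space_restrict_space)
    moreover have "restrict_space ?N (proj ` X) = restrict_space borel (proj ` X)"
      using sub by (simp add: restrict_restrict_space K borel Int_absorb1)
    ultimately show "?\<psi> \<in> measurable (restrict_space ?N (proj ` X)) ?P"
      using measurable_cong_sets[OF refl sets_product_letter_measure[of k p]] by metis
  qed
qed

end

section \<open>Isomorphism of systems with almost everywhere unique codings\<close>

text \<open>
  The conclusion is symmetric in the two systems, and so is the argument: one set \<open>X\<close> of sequences serves
  as a common model of both, and the isomorphism is the composition of the two codings.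
\<close>

theorem isomorphic_ifs_of_null_multiply_coded:
  fixes f :: "nat \<Rightarrow> 'a::euclidean_space \<Rightarrow> 'a" and g :: "nat \<Rightarrow> 'b::euclidean_space \<Rightarrow> 'b"
  assumes f: "contracting_system k f K" and g: "contracting_system k g L"
    and p: "probability_vector k p"
    and null_f: "AE w in product_measure k p. w \<notin> contracting_system.multiply_coded k f K"
    and null_g: "AE w in product_measure k p. w \<notin> contracting_system.multiply_coded k g L"
  shows "isomorphic_ifs k (K, f, projected_measure k p f K) (L, g, projected_measure k p g L)"
proof -
  interpret f: contracting_system k f K by (rule f)
  interpret g: contracting_system k g L by (rule g)
  let ?M = "f.multiply_coded \<union> g.multiply_coded"
  \<comment> \<open>Sequences all of whose extensions by a finite prefix are uniquely coded in both systems.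
    Quantifying over the prefixes makes \<open>X\<close> closed under prepending letters.\<close>
  define X where "X = {w \<in> sequences k. \<forall>u\<in>lists {1..k}. foldr case_nat u w \<notin> ?M}"
  have XS: "X \<subseteq> sequences k" by (auto simp: X_def)
  have words: "countable (lists {1..k})" by simp
  have full: "AE w in product_measure k p. w \<in> X"
  proof -
    have "AE w in product_measure k p. w \<notin> ?M"
      using null_f null_g by eventually_elim auto
    then have "AE w in product_measure k p. \<forall>u\<in>lists {1..k}. foldr case_nat u w \<notin> ?M"
      unfolding AE_ball_countable[OF words] by (intro ballI AE_prepend[OF p, where Q = "\<lambda>w. w \<notin> ?M"])
    then show ?thesis
      using AE_space by eventually_elim (auto simp: X_def space_product_measure)
  qed
  have complement: "sigma_compact (sequences k - X)"
  proof -
    have "sigma_compact (\<Union>u\<in>lists {1..k}. \<Union>M\<in>{f.multiply_coded, g.multiply_coded}.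
        sequences k \<inter> foldr case_nat u -` M)"
      using f.sigma_compact_prepend_multiply_coded g.sigma_compact_prepend_multiply_coded
      by (intro sigma_compact_UN words) auto
    moreover have "sequences k - X = (\<Union>u\<in>lists {1..k}. \<Union>M\<in>{f.multiply_coded, g.multiply_coded}.
        sequences k \<inter> foldr case_nat u -` M)"
      unfolding X_def by blast
    ultimately show ?thesis by simp
  qed
  have "w \<notin> ?M" if "w \<in> X" for w
  proof -
    have "foldr case_nat [] w \<notin> ?M" using that unfolding X_def by blast
    then show ?thesis by simp
  qed
  then have unique: "X \<inter> f.multiply_coded = {}" "X \<inter> g.multiply_coded = {}" by auto
  have prepend: "case_nat i w \<in> X" if w: "w \<in> X" and i: "i \<in> {1..k}" for i w
  proof -
    have "foldr case_nat u (case_nat i w) \<notin> ?M" if u: "u \<in> lists {1..k}" for u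
    proof -
      have "u @ [i] \<in> lists {1..k}" using u i by auto
      then have "foldr case_nat (u @ [i]) w \<notin> ?M" using w unfolding X_def by blast
      then show ?thesis by simp
    qed
    then show ?thesis using w i by (auto simp: X_def intro!: case_nat_in_sequences)
  qed
  note F = f.natural_projection_isomorphism[OF XS complement unique(1) full]
  note G = g.natural_projection_isomorphism[OF XS complement unique(2) full]
  have sp: "space (restrict_space (bernoulli_measure k p) X) = X"
    using XS by (auto simp: space_restrict_space space_bernoulli_measure)
  let ?\<phi> = "f.proj \<circ> the_inv_into X g.proj"
  have iso: "invertible_measure_preserving (restrict_space (projected_measure k p g L) (g.proj ` X))
      (restrict_space (projected_measure k p f K) (f.proj ` X)) ?\<phi>"
    using invertible_measure_preserving_comp[OF invertible_measure_preserving_inverse[OF G(2)] F(2)]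
    by (simp only: sp)
  have inj: "inj_on g.proj X"
    using unique(2) XS by (fastforce simp: inj_on_def g.multiply_coded_def disjoint_iff)
  have "g i x \<in> g.proj ` X \<and> ?\<phi> (g i x) = f i (?\<phi> x)"
    if x: "x \<in> g.proj ` X" and i: "i \<in> {1..k}" for i x
  proof -
    obtain w where w: "w \<in> X" "x = g.proj w" using x by auto
    then have gx: "g i x = g.proj (case_nat i w)"
      using XS i by (auto simp: g.proj_prepend)
    have "?\<phi> (g i x) = f.proj (case_nat i w)"
      using gx prepend[OF w(1) i] inj by (simp add: the_inv_into_f_f)
    also have "\<dots> = f i (f.proj w)" using w XS i by (auto simp: f.proj_prepend)
    also have "f.proj w = ?\<phi> x" using w inj by (simp add: the_inv_into_f_f)
    finally show ?thesis using gx prepend[OF w(1) i] by auto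
  qed
  moreover have "f.proj ` X \<subseteq> K" "g.proj ` X \<subseteq> L"
    using XS f.proj_in_K g.proj_in_K by auto
  ultimately show ?thesis
    using F(1) G(1) iso unfolding isomorphic_ifs.simps by blast
qed

section \<open>Expansions to base \<open>k\<close>\<close>

locale unit_system =
  fixes k :: nat
  assumes base: "2 \<le> k"
begin

sublocale contracting_system k "unit_ifs k" "{0..1}"
  using base by unfold_locales (rule contracting_unit_ifs attractor_unit_ifs; assumption)+

lemma proj_expansion:
  assumes "w \<in> sequences k"
  shows "real k * proj w = proj (\<lambda>n. w (Suc n)) + real (w 0) - 1"
  using base by (simp add: proj_head_tail[OF assms] unit_ifs_def field_simps)

text \<open>
  The end point \<open>1\<close> is attained only with the largest digit throughout: any smaller first digit leaves a
  tail that would have to exceed \<open>1\<close>. The end point \<open>0\<close> is treated in the same way.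
\<close>

lemma proj_eq_1_imp:
  assumes "w \<in> sequences k" "proj w = 1"
  shows "w n = k"
  using assms
proof (induction n arbitrary: w)
  have *: "w 0 = k \<and> proj (\<lambda>n. w (Suc n)) = 1" if w: "w \<in> sequences k" "proj w = 1" for w
  proof -
    have "proj (\<lambda>n. w (Suc n)) \<le> 1" using proj_in_K[OF tail_in_sequences[OF w(1)]] by simp
    moreover have "w 0 \<le> k" using w by (auto simp: sequences_def)
    moreover have "real k = proj (\<lambda>n. w (Suc n)) + real (w 0) - 1"
      using proj_expansion[OF w(1)] w(2) by simp
    ultimately show ?thesis by linarith
  qed
  {
    case 0
    then show ?case using * by blast
  next
    case (Suc n)
    then show ?case using *[OF Suc.prems] Suc.IH[of "\<lambda>n. w (Suc n)"] tail_in_sequences by blast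
  }
qed

lemma proj_eq_0_imp:
  assumes "w \<in> sequences k" "proj w = 0"
  shows "w n = 1"
  using assms
proof (induction n arbitrary: w)
  have *: "w 0 = 1 \<and> proj (\<lambda>n. w (Suc n)) = 0" if w: "w \<in> sequences k" "proj w = 0" for w
  proof -
    have "proj (\<lambda>n. w (Suc n)) \<ge> 0" using proj_in_K[OF tail_in_sequences[OF w(1)]] by simp
    moreover have "w 0 \<ge> 1" using w by (auto simp: sequences_def)
    moreover have "0 = proj (\<lambda>n. w (Suc n)) + real (w 0) - 1"
      using proj_expansion[OF w(1)] w(2) by simp
    ultimately show ?thesis by linarith
  qed
  {
    case 0
    then show ?case using * by blast
  next
    case (Suc n)
    then show ?case using *[OF Suc.prems] Suc.IH[of "\<lambda>n. w (Suc n)"] tail_in_sequences by blast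
  }
qed

text \<open>
  At the first place where two expansions of one number differ, the digits differ by at least \<open>1\<close>, while
  the values of the tails lie in \<open>[0, 1]\<close>. So the tails have the values \<open>0\<close> and \<open>1\<close>, which have only
  constant expansions.
\<close>

lemma multiply_coded_eventually_constant:
  assumes "w \<in> sequences k" "v \<in> sequences k" "w m \<noteq> v m" "proj w = proj v"
  shows "\<exists>n. \<exists>c\<in>{1, k}. \<forall>l\<ge>n. w l = c"
  using assms
proof (induction m arbitrary: w v)
  have shift: "\<exists>n. \<exists>c\<in>{1, k}. \<forall>l\<ge>n. w l = c"
    if w: "\<exists>n. \<exists>c\<in>{1, k}. \<forall>l\<ge>n. w (Suc l) = c" for w :: "nat \<Rightarrow> nat"
  proof -
    obtain n c where "c \<in> {1, k}" "\<And>l. l \<ge> n \<Longrightarrow> w (Suc l) = c" using w by blast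
    then have "\<forall>l\<ge>Suc n. w l = c" by (metis Suc_le_D Suc_le_mono)
    then show ?thesis using \<open>c \<in> {1, k}\<close> by blast
  qed
  have first: "\<exists>n. \<exists>c\<in>{1, k}. \<forall>l\<ge>n. w l = c"
    if w: "w \<in> sequences k" and v: "v \<in> sequences k" and "w 0 \<noteq> v 0" "proj w = proj v" for w v
  proof (rule shift)
    let ?w = "\<lambda>n. w (Suc n)" and ?v = "\<lambda>n. v (Suc n)"
    have S: "?w \<in> sequences k" "?v \<in> sequences k" using w v by (auto intro: tail_in_sequences)
    have "proj ?w + real (w 0) = proj ?v + real (v 0)"
      using proj_expansion[OF w] proj_expansion[OF v] that(4) by simp
    moreover have "0 \<le> proj ?w" "proj ?w \<le> 1" "0 \<le> proj ?v" "proj ?v \<le> 1"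
      using proj_in_K[OF S(1)] proj_in_K[OF S(2)] by auto
    ultimately have "proj ?w = 1 \<or> proj ?w = 0"
      using \<open>w 0 \<noteq> v 0\<close> by linarith
    then show "\<exists>n. \<exists>c\<in>{1, k}. \<forall>l\<ge>n. w (Suc l) = c"
      using proj_eq_1_imp[OF S(1)] proj_eq_0_imp[OF S(1)] by blast
  qed
  {
    case 0
    then show ?case using first by blast
  next
    case (Suc m)
    show ?case
    proof (cases "w 0 = v 0")
      case True
      then have "proj (\<lambda>n. w (Suc n)) = proj (\<lambda>n. v (Suc n))"
        using proj_expansion[OF Suc.prems(1)] proj_expansion[OF Suc.prems(2)] Suc.prems(4) by simp
      then have "\<exists>n. \<exists>c\<in>{1, k}. \<forall>l\<ge>n. w (Suc l) = c"
        using Suc.prems by (intro Suc.IH[of "\<lambda>n. w (Suc n)" "\<lambda>n. v (Suc n)"] tail_in_sequences)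
      then show ?thesis by (rule shift)
    next
      case False
      then show ?thesis using first Suc.prems by blast
    qed
  }
qed

lemma AE_not_multiply_coded:
  assumes p: "probability_vector k p"
  shows "AE w in product_measure k p. w \<notin> multiply_coded"
proof -
  have "AE w in product_measure k p. \<forall>n. \<forall>c\<in>{1, k}. \<exists>l\<ge>n. w l \<noteq> c"
    unfolding AE_all_countable
  proof
    fix n
    have "AE w in product_measure k p. \<exists>l\<ge>n. w l \<noteq> c" if "c \<in> {1, k}" for c
      using that base by (intro AE_not_eventually_constant[OF p]) auto
    then show "AE w in product_measure k p. \<forall>c\<in>{1, k}. \<exists>l\<ge>n. w l \<noteq> c"
      by (subst AE_ball_countable) auto
  qed
  then show ?thesis
  proof eventually_elim
    case (elim w)
    show ?case
    proof
      assume "w \<in> multiply_coded"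
      then obtain v where "w \<in> sequences k" "v \<in> sequences k" "v \<noteq> w" "proj w = proj v"
        by (auto simp: multiply_coded_def)
      moreover from \<open>v \<noteq> w\<close> obtain m where "w m \<noteq> v m" by (metis ext)
      ultimately show False
        using multiply_coded_eventually_constant elim by blast
    qed
  qed
qed

end

section \<open>The isomorphism theorem\<close>

theorem theorem5p7:
  fixes k :: nat and f :: "nat \<Rightarrow> real ^ 'n \<Rightarrow> real ^ 'n" and K :: "(real ^ 'n) set"
    and p :: "nat \<Rightarrow> real"
  assumes "contracting_ifs k f"
    and "is_attractor k f K"
    and "probability_vector k p"
    and "{w \<in> sequences k.
           let F = {v \<in> sequences k. natural_projection f K v = natural_projection f K w}
           in infinite F \<or> card F > 1} \<in> null_sets (bernoulli_measure k p)"
  shows "isomorphic_ifs k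
           (K, f, projected_measure k p f K)
           ({0..1}, unit_ifs k, projected_measure k p (unit_ifs k) {0..1})"
proof -
  interpret f: contracting_system k f K
    using assms(1,2) by unfold_locales
  interpret g: unit_system k
    using contracting_ifs_ge_2[OF assms(1)] by unfold_locales
  have "f.multiply_coded \<in> null_sets (completion (product_measure k p))"
    using assms(4) unfolding f.multiply_coded_eq bernoulli_measure_def .
  then have "AE w in product_measure k p. w \<notin> f.multiply_coded"
    by (metis AE_not_in AE_completion_iff)
  then show ?thesis
    using isomorphic_ifs_of_null_multiply_coded[OF f.contracting_system_axioms
        g.contracting_system_axioms assms(3) _ g.AE_not_multiply_coded[OF assms(3)]]
    by blast
qed

end
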